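(* Let $C$ be any bivariate copula with $\mu_\infty(C)=m$. Then $\gamma(C)\in[g(m),h(m)]$, where \[ g(m)=\begin{cases}4m^2-1, & \text{if }0\leqslant m\leqslant\frac14,\\ 20m^2-8m, & \text{if }\frac14\leqslant m\leqslant\frac13,\end{cases} \qquad h(m)=\begin{cases}1-8m^2, & \text{if }0\leqslant m\leqslant\frac16,\\ 12m-44m^2, & \text{if }\frac16\leqslant m\leqslant\frac15,\\ 1+2m-19m^2, & \text{if }\frac15\leqslant m\leqslant\frac14,\\ 2-6m-3m^2, & \text{if }\frac14\leqslant m\leqslant\frac13,\end{cases} \] and the bounds are attained (for each $m\in[0,\frac13]$, each of the two bounds is attained by some copula $C$ with $\mu_\infty(C)=m$). In particular, if $C$ is symmetric (i.e. $C(u,v)=C(v,u)$ for all $u,v$), then $\gamma(C)$ can take any value in $[-1,1]$; and if $C$ takes the maximal possible asymmetry $\mu_\infty(C)=\frac13$, then $\gamma(C)\in[-\frac49,-\frac13]$.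
   Context: For a bivariate copula $C$, the measure of asymmetry is $\mu_\infty(C)=\max_{u,v\in[0,1]}|C(u,v)-C(v,u)|$; its range over all copulas is $[0,\frac13]$. For copulas $C_1,C_2$ the concordance function is $\mathcal{Q}(C_1,C_2)=4\int_{[0,1]^2}C_2(u,v)\,dC_1(u,v)-1$. Gini's gamma is $\gamma(C)=\mathcal{Q}(C,M)+\mathcal{Q}(C,W)$, where $M(u,v)=\min\{u,v\}$ and $W(u,v)=\max\{0,u+v-1\}$. *)

theory Defs
  imports "HOL-Analysis.Analysis"
begin

text \<open>Bivariate functions on the unit square are represented by total functions on the reals; none
  of the notions below depends on the values outside the unit square.\<close>

definition copula :: "(real \<Rightarrow> real \<Rightarrow> real) \<Rightarrow> bool" where
  "copula C \<longleftrightarrow>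
     (\<forall>u\<in>{0..1}. C u 0 = 0 \<and> C 0 u = 0) \<and>
     (\<forall>u\<in>{0..1}. C u 1 = u \<and> C 1 u = u) \<and>
     (\<forall>u1\<in>{0..1}. \<forall>u2\<in>{0..1}. \<forall>v1\<in>{0..1}. \<forall>v2\<in>{0..1}. u1 \<le> u2 \<longrightarrow> v1 \<le> v2 \<longrightarrow>
        C u2 v2 - C u2 v1 - C u1 v2 + C u1 v1 \<ge> 0)"

definition symmetric_copula :: "(real \<Rightarrow> real \<Rightarrow> real) \<Rightarrow> bool" where
  "symmetric_copula C \<longleftrightarrow> copula C \<and> (\<forall>u\<in>{0..1}. \<forall>v\<in>{0..1}. C u v = C v u)"

definition copula_M :: "real \<Rightarrow> real \<Rightarrow> real" where
  "copula_M u v = min u v"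

definition copula_W :: "real \<Rightarrow> real \<Rightarrow> real" where
  "copula_W u v = max 0 (u + v - 1)"

text \<open>A copula is continuous, so the supremum is a maximum.\<close>

definition asymmetry :: "(real \<Rightarrow> real \<Rightarrow> real) \<Rightarrow> real" where
  "asymmetry C = (SUP (u, v) \<in> {0..1} \<times> {0..1}. \<bar>C u v - C v u\<bar>)"

text \<open>The Borel probability measure on the unit square with joint distribution function \<open>C\<close>. For a
  copula it exists, and it is unique because the boxes \<open>[0,u] \<times> [0,v]\<close> are closed under
  intersection, contain the whole square and generate its Borel sets. \<^const>\<open>extend_measure\<close> yields
  the null measure when no extension exists.\<close>

definition copula_measure :: "(real \<Rightarrow> real \<Rightarrow> real) \<Rightarrow> (real \<times> real) measure" where
  "copula_measure C =
     extend_measure ({0..1} \<times> {0..1}) ({0..1} \<times> {0..1})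
       (\<lambda>(u, v). {0..u} \<times> {0..v}) (\<lambda>(u, v). ennreal (C u v))"

definition concordance :: "(real \<Rightarrow> real \<Rightarrow> real) \<Rightarrow> (real \<Rightarrow> real \<Rightarrow> real) \<Rightarrow> real" where
  "concordance C1 C2 = 4 * (\<integral>p. C2 (fst p) (snd p) \<partial>copula_measure C1) - 1"

definition gini_gamma :: "(real \<Rightarrow> real \<Rightarrow> real) \<Rightarrow> real" where
  "gini_gamma C = concordance C copula_M + concordance C copula_W"

text \<open>The bounds are only meaningful for \<open>0 \<le> m \<le> 1/3\<close>; adjacent pieces agree at the breakpoints.\<close>

definition gamma_lower :: "real \<Rightarrow> real" where
  "gamma_lower m = (if m \<le> 1/4 then 4 * m^2 - 1 else 20 * m^2 - 8 * m)"

definition gamma_upper :: "real \<Rightarrow> real" where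
  "gamma_upper m =
     (if m \<le> 1/6 then 1 - 8 * m^2
      else if m \<le> 1/5 then 12 * m - 44 * m^2
      else if m \<le> 1/4 then 1 + 2 * m - 19 * m^2
      else 2 - 6 * m - 3 * m^2)"

end

(*
  Gini's gamma only depends on the two diagonal sections:
  gamma(C) = 4 (int C(t,t) dt + int C(t,1-t) dt) - 2.
  After transposing C if necessary, the asymmetry m is attained at a <= b with C(a,b) = C(b,a) + m.
  Then m <= a <= b - m and b <= 1 - m, and monotonicity together with the 1-Lipschitz property
  of C, started from (a,b) for the lower and from (b,a) for the upper bound, confines both
  sections between piecewise linear functions whose integrals give g(m) and h(m). The bounds are
  attained by the least copula with value m at (m, 1-m) and the greatest one with value 0 at (2m, m).
*)
theory Submission
  imports Defs
begin

section \<open>The measure of a copula\<close>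

text \<open>Integrals against \<open>copula_measure C\<close> say something about \<open>C\<close>
  only if a measure with the prescribed box values exists, since \<open>extend_measure\<close>
  otherwise returns the null measure. So a measure is first built for an arbitrary copula, with
  Radon-Nikodym densities as conditional distribution functions. The integrals then reduce to
  survival probabilities, which the box values determine. The two diagonal sections are estimated
  separately, and separate estimates are jointly sharp only if one copula is extremal on both. It
  is, because one position of (a,b) is worst for both sections: (m, 1-m) for the lower bound and (m,
  2m) for the upper. The pieces of g and h record where the linear bounds start to cross as m
  grows.\<close>

text \<open>The sum of the two measures is again a measure and gives half-open intervals the same
  finite values. These intervals are closed under intersection, generate the Borel sets and exhaust
  the line. The rule lets distribution functions be compared through their differences.\<close>

lemma interval_measure_add:
  fixes F H :: "real \<Rightarrow> real"
  assumes F: "mono F" "continuous_on UNIV F" and H: "mono H" "continuous_on UNIV H"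
    and A: "A \<in> sets borel"
  shows "emeasure (interval_measure (\<lambda>x. F x + H x)) A =
    emeasure (interval_measure F) A + emeasure (interval_measure H) A"
proof -
  define \<mu> where "\<mu> = (\<lambda>A. emeasure (interval_measure F) A + emeasure (interval_measure H) A)"
  define S where "S = measure_of UNIV (sets borel) \<mu>"
  have sets_S: "sets S = sets borel"
    unfolding S_def by (simp add: sets.sigma_sets_eq[of borel, simplified])
  have S: "emeasure S B = \<mu> B" if "B \<in> sets borel" for B
  proof (rule emeasure_measure_of[OF S_def])
    show "positive (sets S) \<mu>" by (simp add: positive_def \<mu>_def)
    show "countably_additive (sets S) \<mu>"
      unfolding sets_S
    proof (rule countably_additiveI)
      fix B :: "nat \<Rightarrow> real set"
      assume B: "range B \<subseteq> sets borel" "disjoint_family B"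
      then show "(\<Sum>i. \<mu> (B i)) = \<mu> (\<Union> (range B))"
        unfolding \<mu>_def by (subst suminf_add[symmetric]) (auto simp: suminf_emeasure)
    qed
  qed (use that sets_S in auto)
  have right: "continuous (at_right x) F" "continuous (at_right x) H" for x
    using F H by (auto simp: continuous_on_eq_continuous_at intro: continuous_within_subset)
  have Ioc: "emeasure (interval_measure (\<lambda>x. F x + H x)) {x<..y} = emeasure S {x<..y}"
    "emeasure (interval_measure (\<lambda>x. F x + H x)) {x<..y} \<noteq> \<infinity>" for x y
    using F H right
    by (auto simp: S \<mu>_def emeasure_interval_measure_Ioc_eq monoD add_mono continuous_add
        simp flip: ennreal_plus)
  have "interval_measure (\<lambda>x. F x + H x) = S"
  proof (rule measure_eqI_generator_eq[where \<Omega> = UNIV])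
    let ?E = "range (\<lambda>(a, b). {a<..b::real})"
    show "Int_stable ?E"
      by (auto simp: Int_stable_def)
    show "sets (interval_measure (\<lambda>x. F x + H x)) = sigma_sets UNIV ?E" "sets S = sigma_sets UNIV ?E"
      by (simp_all add: sets_S borel_sigma_sets_Ioc)
    show "range (\<lambda>n. {- real n<..real n}) \<subseteq> ?E" by auto
    show "(\<Union>n. {- real n<..real n}) = UNIV"
    proof (auto)
      fix x :: real
      obtain n where "\<bar>x\<bar> < real n" using reals_Archimedean2 by blast
      then show "\<exists>n. - real n < x \<and> x \<le> real n" by (intro exI[of _ n]) auto
    qed
  qed (use Ioc in auto)
  with S[OF A] show ?thesis by (simp add: \<mu>_def)
qed

section \<open>Densities with respect to the uniform distribution\<close>

definition cut01 :: "real \<Rightarrow> real" where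
  "cut01 s = max 0 (min 1 s)"

abbreviation unif :: "real measure" where
  "unif \<equiv> interval_measure cut01"

lemma cut01_props: "mono cut01" "continuous_on UNIV cut01" "cut01 s \<in> {0..1}"
  by (auto simp: cut01_def mono_def intro!: continuous_intros)

lemma cut01_id: "s \<in> {0..1} \<Longrightarrow> cut01 s = s"
  by (auto simp: cut01_def)

lemma emeasure_unif_Icc:
  "0 \<le> x \<Longrightarrow> x \<le> 1 \<Longrightarrow> emeasure unif {0..x} = ennreal x"
  using emeasure_interval_measure_Icc[of 0 x cut01] cut01_props
  by (simp add: monoD cut01_id)

lemma sigma_finite_unif: "sigma_finite_measure unif"
  by (rule sigma_finite_interval_measure)
    (use cut01_props in \<open>auto simp: continuous_on_eq_continuous_at monoD intro: continuous_within_subset\<close>)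

text \<open>Monotonicity of \<open>cut01 s - F s\<close> means that \<open>F\<close> grows no faster
  than the uniform distribution function. Additivity then splits \<open>unif\<close> into
  \<open>interval_measure F\<close> and a second measure, so \<open>unif\<close> dominates and
  Radon-Nikodym applies.\<close>

lemma subdensity:
  assumes F: "mono F" "continuous_on UNIV F" and H: "mono (\<lambda>s. cut01 s - F s)"
  obtains f :: "real \<Rightarrow> ennreal" where "f \<in> borel_measurable borel" "density unif f = interval_measure F"
proof -
  interpret sigma_finite_measure unif by (rule sigma_finite_unif)
  have "emeasure (interval_measure F) A \<le> emeasure unif A" if "A \<in> sets borel" for A
    using interval_measure_add[OF F H _ that] F(2) cut01_props(2)
    by (auto simp: continuous_on_diff le_iff_add intro: sym)
  then have "absolutely_continuous unif (interval_measure F)"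
    by (auto simp: absolutely_continuous_def null_sets_def) (metis le_zero_eq)
  from Radon_Nikodym[OF this] show thesis
    by (auto intro: that simp: measurable_cong_sets[OF sets_interval_measure refl])
qed

text \<open>The difference \<open>G - F\<close> has a density \<open>h\<close> of its own. Then
  \<open>f + h\<close> and \<open>g\<close> are densities of the same measure, hence equal almost
  everywhere.\<close>

lemma subdensity_mono:
  assumes F: "mono F" "continuous_on UNIV F" and G: "continuous_on UNIV G"
    and GF: "mono (\<lambda>s. G s - F s)" and H: "mono (\<lambda>s. cut01 s - (G s - F s))"
    and f: "f \<in> borel_measurable borel" "density unif f = interval_measure F"
    and g: "g \<in> borel_measurable borel" "density unif g = interval_measure G"
  shows "AE s in unif. f s \<le> g s"
proof -
  interpret sigma_finite_measure unif by (rule sigma_finite_unif)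
  have cont: "continuous_on UNIV (\<lambda>s. G s - F s)" using F G by (intro continuous_intros)
  obtain h where h: "h \<in> borel_measurable borel" "density unif h = interval_measure (\<lambda>s. G s - F s)"
    using subdensity[OF GF cont H] by blast
  have "density unif (\<lambda>s. f s + h s) = density unif g"
  proof (rule measure_eqI)
    fix A assume "A \<in> sets (density unif (\<lambda>s. f s + h s))"
    then have A: "A \<in> sets borel" by simp
    have "emeasure (density unif (\<lambda>s. f s + h s)) A = emeasure (density unif f) A + emeasure (density unif h) A"
      using A f(1) h(1) by (simp add: emeasure_density distrib_right nn_integral_add)
    also have "\<dots> = emeasure (density unif g) A"
      using interval_measure_add[OF F GF cont A] by (simp add: f g h)
    finally show "emeasure (density unif (\<lambda>s. f s + h s)) A = emeasure (density unif g) A" .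
  qed simp
  then have "AE s in unif. f s + h s = g s"
    using f g h by (subst (asm) density_unique_iff) auto
  then show ?thesis by eventually_elim (metis le_iff_add)
qed

section \<open>Elementary estimates for copulas\<close>

lemma copula_zero: "copula C \<Longrightarrow> u \<in> {0..1} \<Longrightarrow> C u 0 = 0 \<and> C 0 u = 0"
  and copula_one: "copula C \<Longrightarrow> u \<in> {0..1} \<Longrightarrow> C u 1 = u \<and> C 1 u = u"
  and copula_rectangle: "copula C \<Longrightarrow> {u1, u2, v1, v2} \<subseteq> {0..1} \<Longrightarrow> u1 \<le> u2 \<Longrightarrow> v1 \<le> v2 \<Longrightarrow>
    C u2 v2 - C u2 v1 - C u1 v2 + C u1 v1 \<ge> 0"
  by (auto simp: copula_def)

text \<open>The rectangle inequality on [u1,u2] x [0,v] gives monotonicity, and on [u1,u2] x [v,1]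
  the Lipschitz bound.\<close>

lemma copula_increment_left:
  assumes "copula C" "{u1, u2, v} \<subseteq> {0..1}" "u1 \<le> u2"
  shows "C u1 v \<le> C u2 v" "C u2 v - C u1 v \<le> u2 - u1"
  using copula_rectangle[of C u1 u2 0 v] copula_rectangle[of C u1 u2 v 1]
    copula_zero[of C u1] copula_zero[of C u2] copula_one[of C u1] copula_one[of C u2] assms
  by auto

lemma copula_increment_right:
  assumes "copula C" "{u, v1, v2} \<subseteq> {0..1}" "v1 \<le> v2"
  shows "C u v1 \<le> C u v2" "C u v2 - C u v1 \<le> v2 - v1"
  using copula_rectangle[of C 0 u v1 v2] copula_rectangle[of C u 1 v1 v2]
    copula_zero[of C v1] copula_zero[of C v2] copula_one[of C v1] copula_one[of C v2] assms
  by auto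

text \<open>These are the Frechet-Hoeffding bounds W and M.\<close>

lemma copula_bounds:
  assumes "copula C" "u \<in> {0..1}" "v \<in> {0..1}"
  shows "0 \<le> C u v" "u + v - 1 \<le> C u v" "C u v \<le> u" "C u v \<le> v"
  using copula_increment_left[of C 0 u v] copula_increment_right[of C u 0 v]
    copula_increment_left[of C u 1 v] copula_zero[of C v] copula_zero[of C u] copula_one[of C v] assms
  by auto

lemma copula_transpose: "copula C \<Longrightarrow> copula (\<lambda>u v. C v u)"
  unfolding copula_def
  by (intro conjI ballI impI; elim conjE) (simp_all, smt (verit, best) atLeastAtMost_iff)

text \<open>On the way from (u,v) to (u',v') a rising coordinate cannot lower \<open>C\<close>, and
  a falling one costs at most its drop. Continuity and all later bounds on the diagonal sections
  come from this one-sided estimate.\<close>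

lemma copula_mono_lipschitz:
  assumes "copula C" "{u, v, u', v'} \<subseteq> {0..1}"
  shows "C u v \<le> C u' v' + max 0 (u - u') + max 0 (v - v')"
  using copula_increment_left[of C u u' v] copula_increment_left[of C u' u v]
    copula_increment_right[of C u' v v'] copula_increment_right[of C u' v' v] assms
  by (auto simp: max_def)

lemma copula_continuous:
  assumes "copula C"
  shows "continuous_on ({0..1} \<times> {0..1}) (\<lambda>p. C (fst p) (snd p))"
proof (rule continuous_onI)
  fix p :: "real \<times> real" and e :: real
  assume p: "p \<in> {0..1} \<times> {0..1}" and e: "0 < e"
  show "\<exists>d>0. \<forall>q\<in>{0..1} \<times> {0..1}. dist q p < d \<longrightarrow> dist (C (fst q) (snd q)) (C (fst p) (snd p)) \<le> e"
  proof (intro exI[of _ "e / 2"] conjI ballI impI)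
    show "0 < e / 2" using e by simp
    fix q assume q: "q \<in> {0..1} \<times> {0..1}" "dist q p < e / 2"
    obtain u v u' v' where uv: "p = (u, v)" "q = (u', v')" by (metis prod.exhaust)
    have "\<bar>u' - u\<bar> < e / 2" "\<bar>v' - v\<bar> < e / 2"
      using q(2) dist_fst_le[of q p] dist_snd_le[of q p] by (auto simp: uv dist_real_def)
    then have "max 0 (u - u') < e / 2" "max 0 (u' - u) < e / 2" "max 0 (v - v') < e / 2" "max 0 (v' - v) < e / 2"
      unfolding max_def abs_if by (auto split: if_splits)
    moreover have "C u v \<le> C u' v' + max 0 (u - u') + max 0 (v - v')"
      "C u' v' \<le> C u v + max 0 (u' - u) + max 0 (v' - v)"
      using p q by (auto intro!: copula_mono_lipschitz[OF assms] simp: uv)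
    ultimately show "dist (C (fst q) (snd q)) (C (fst p) (snd p)) \<le> e"
      unfolding uv dist_real_def fst_conv snd_conv abs_le_iff by (intro conjI) linarith+
  qed
qed

lemma copula_continuous_compose:
  assumes "copula C" "continuous_on S f" "continuous_on S g" "f ` S \<subseteq> {0..1}" "g ` S \<subseteq> {0..1}"
  shows "continuous_on S (\<lambda>t. C (f t) (g t))"
proof -
  have "continuous_on S ((\<lambda>p. C (fst p) (snd p)) \<circ> (\<lambda>t. (f t, g t)))"
    using assms
    by (intro continuous_on_compose continuous_on_Pair continuous_on_subset[OF copula_continuous]) auto
  then show ?thesis by (simp add: o_def)
qed

section \<open>Existence of a Borel measure with distribution function \<open>C\<close>\<close>

lemma copula_densities:
  assumes C: "copula C"
  obtains f :: "real \<Rightarrow> real \<Rightarrow> ennreal" where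
    "\<And>q. q \<in> {0..1} \<Longrightarrow> f q \<in> borel_measurable borel"
    "\<And>q u. q \<in> {0..1} \<Longrightarrow> u \<in> {0..1} \<Longrightarrow> (\<integral>\<^sup>+s\<in>{0..u}. f q s \<partial>unif) = ennreal (C u q)"
    "\<And>p q. p \<in> {0..1} \<Longrightarrow> q \<in> {0..1} \<Longrightarrow> p \<le> q \<Longrightarrow> AE s in unif. f p s \<le> f q s"
    "f 1 = (\<lambda>_. 1)"
proof -
  \<comment> \<open>Clamping extends the section constantly beyond the unit interval, so that it
    becomes a monotone continuous function on the whole line.\<close>
  define F where "F q = (\<lambda>s. C (cut01 s) q)" for q
  have cut: "cut01 s \<in> {0..1}" for s by (rule cut01_props)
  have F_mono: "mono (F q)" if "q \<in> {0..1}" for q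
    unfolding F_def using that cut[unfolded atLeastAtMost_iff]
    by (intro monoI copula_increment_left(1)[OF C]) (simp_all add: monoD[OF cut01_props(1)])
  have F_cont: "continuous_on UNIV (F q)" if "q \<in> {0..1}" for q
    unfolding F_def using that cut
    by (intro copula_continuous_compose[OF C] cut01_props(2)) (simp_all add: image_subset_iff)
  have F_diff: "mono (\<lambda>s. F q s - F p s)" if "p \<in> {0..1}" "q \<in> {0..1}" "p \<le> q" for p q
  proof (rule monoI)
    fix x y :: real assume "x \<le> y"
    then have "cut01 x \<le> cut01 y" using cut01_props(1) by (simp add: monoD)
    then show "F q x - F p x \<le> F q y - F p y"
      using copula_rectangle[OF C, of "cut01 x" "cut01 y" p q] that cut[of x] cut[of y]
      by (auto simp: F_def)
  qed
  have F_diff_cut: "mono (\<lambda>s. cut01 s - (F q s - F p s))" if "p \<in> {0..1}" "q \<in> {0..1}" "p \<le> q" for p q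
  proof (rule monoI)
    fix x y :: real assume "x \<le> y"
    then have "cut01 x \<le> cut01 y" using cut01_props(1) by (simp add: monoD)
    then show "cut01 x - (F q x - F p x) \<le> cut01 y - (F q y - F p y)"
      using copula_increment_left[OF C, of "cut01 x" "cut01 y" p] copula_increment_left[OF C, of "cut01 x" "cut01 y" q] that cut[of x] cut[of y]
      by (auto simp: F_def)
  qed
  have F_zero: "F 0 s = 0" for s using copula_zero[OF C cut] by (simp add: F_def)
  have F_one: "F 1 = cut01" using copula_one[OF C cut] by (simp add: F_def fun_eq_iff)
  \<comment> \<open>At \<open>q = 1\<close> the density is fixed to be the constant 1 instead of
    being chosen up to null sets; comparison with \<open>f 1\<close> then bounds every
    \<open>f q\<close> by 1 almost everywhere.\<close>
  have "\<exists>f :: real \<Rightarrow> ennreal. f \<in> borel_measurable borel \<and> density unif f = interval_measure (F q) \<and>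
      (q = 1 \<longrightarrow> f = (\<lambda>_. 1))" if "q \<in> {0..1}" for q
  proof (cases "q = 1")
    case True
    then show ?thesis
      by (intro exI[of _ "\<lambda>_. 1"]) (simp add: F_one density_1)
  next
    case False
    show ?thesis
      using subdensity[OF F_mono[OF that] F_cont[OF that]] F_diff_cut[of 0 q] that False
      by (simp add: F_zero) metis
  qed
  then obtain f :: "real \<Rightarrow> real \<Rightarrow> ennreal" where f: "\<And>q. q \<in> {0..1} \<Longrightarrow> f q \<in> borel_measurable borel"
    "\<And>q. q \<in> {0..1} \<Longrightarrow> density unif (f q) = interval_measure (F q)" "f 1 = (\<lambda>_. 1)"
    by (metis atLeastAtMost_iff order_refl zero_le_one)
  show thesis
  proof (rule that[of f])
    fix q u :: real assume q: "q \<in> {0..1}" and u: "u \<in> {0..1}"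
    have "(\<integral>\<^sup>+s\<in>{0..u}. f q s \<partial>unif) = emeasure (interval_measure (F q)) {0..u}"
      using f q by (simp flip: f(2) add: emeasure_density)
    also have "\<dots> = F q u - F q 0"
      using F_mono[OF q] F_cont[OF q] u by (intro emeasure_interval_measure_Icc) (auto simp: monoD)
    finally show "(\<integral>\<^sup>+s\<in>{0..u}. f q s \<partial>unif) = ennreal (C u q)"
      using u q copula_zero[OF C q] by (simp add: F_def cut01_id)
  next
    fix p q :: real assume pq: "p \<in> {0..1}" "q \<in> {0..1}" "p \<le> q"
    show "AE s in unif. f p s \<le> f q s"
      using pq f by (intro subdensity_mono[OF F_mono F_cont F_cont F_diff F_diff_cut])
  qed (use f in auto)
qed

lemma rat_between_unit:
  fixes v e :: real
  assumes "v \<in> {0..1}" "e > 0"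
  shows "\<exists>q\<in>\<rat> \<inter> {0..1}. v - e \<le> q \<and> q \<le> v"
proof (cases "v = 0")
  case True
  then show ?thesis using assms by (intro bexI[of _ 0]) auto
next
  case False
  then have "max 0 (v - e) < v" using assms by auto
  then obtain q where "q \<in> \<rat>" "max 0 (v - e) < q" "q < v" using Rats_dense_in_real by blast
  then show ?thesis using assms by (intro bexI[of _ q]) auto
qed

text \<open>Disintegration: the first coordinate is uniform, and given \<open>s\<close> the second one is the quantile
  \<open>V s w\<close> of an independent uniform \<open>w\<close>. The conditional distribution function is the density of
  \<open>u \<mapsto> C u q\<close>; it is monotone in \<open>q\<close> only up to null sets, so \<open>q\<close> ranges over the rationals.\<close>

lemma copula_borel_measure_exists:
  assumes C: "copula C"
  obtains P :: "(real \<times> real) measure" where "sets P = sets borel"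
    "\<And>u v. u \<in> {0..1} \<Longrightarrow> v \<in> {0..1} \<Longrightarrow> emeasure P ({0..u} \<times> {0..v}) = ennreal (C u v)"
proof -
  obtain f where f_meas: "\<And>q. q \<in> {0..1} \<Longrightarrow> f q \<in> borel_measurable borel"
    and f_int: "\<And>q u. q \<in> {0..1} \<Longrightarrow> u \<in> {0..1} \<Longrightarrow> (\<integral>\<^sup>+s\<in>{0..u}. f q s \<partial>unif) = ennreal (C u q)"
    and f_mono: "\<And>p q. p \<in> {0..1} \<Longrightarrow> q \<in> {0..1} \<Longrightarrow> p \<le> q \<Longrightarrow> AE s in unif. f p s \<le> f q s"
    and f_one: "f 1 = (\<lambda>_. 1)"
    using copula_densities[OF C] by blast
  define Q :: "real set" where "Q = \<rat> \<inter> {0..1}"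
  have Q: "countable Q" "Q \<subseteq> {0..1}" "0 \<in> Q" "1 \<in> Q"
    by (auto simp: Q_def countable_rat)
  have AE_mono: "AE s in unif. \<forall>p\<in>Q. \<forall>q\<in>Q. p \<le> q \<longrightarrow> f p s \<le> f q s"
    using Q f_mono by (auto simp: AE_ball_countable subset_iff)
  define L where "L = density lborel (indicator {0..1::real})"
  have L_sets[measurable_cong]: "sets L = sets borel" by (simp add: L_def)
  have L_below: "emeasure L {..x} = ennreal x" if "0 \<le> x" "x \<le> 1" for x
  proof -
    have "emeasure L {..x} = (\<integral>\<^sup>+t. indicator {0..1} t * indicator {..x} t \<partial>lborel)"
      unfolding L_def by (simp add: emeasure_density)
    also have "\<dots> = (\<integral>\<^sup>+t. indicator {0..x} t \<partial>lborel)"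
      using that by (intro nn_integral_cong) (auto split: split_indicator)
    finally show ?thesis using that by simp
  qed
  have L_UNIV: "emeasure L UNIV = 1"
    unfolding L_def by (subst emeasure_density) auto
  interpret L: finite_measure L
    by (rule finite_measureI) (metis L_UNIV L_sets ennreal_one_neq_top infinity_ennreal_def sets_eq_imp_space_eq space_borel)
  interpret U: sigma_finite_measure unif by (rule sigma_finite_unif)
  \<comment> \<open>The default 1 keeps the index set of the infimum fixed and countable, which
    gives measurability, and keeps the values in the unit interval.\<close>
  define V where "V s w = (INF q\<in>Q. if ennreal w \<le> f q s then q else 1)" for s w :: real
  have V_bdd: "bdd_below ((\<lambda>q. if ennreal w \<le> f q s then q else 1) ` Q)" for s w
    using Q by (intro bdd_belowI[of _ 0]) auto
  have V_less: "V s w < v \<longleftrightarrow> (\<exists>q\<in>Q. ennreal w \<le> f q s \<and> q < v) \<or> 1 < v" for s w v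
    unfolding V_def using Q by (subst cINF_less_iff[OF _ V_bdd]) auto
  have V_le: "V s w \<le> q" if "q \<in> Q" "ennreal w \<le> f q s" for s w q
    using cINF_lower[OF V_bdd that(1), of w s] that(2) by (simp only: V_def if_True)
  have V_range: "0 \<le> V s w" "V s w \<le> 1" for s w
  proof -
    show "0 \<le> V s w" unfolding V_def using Q by (intro cINF_greatest) auto
    have "V s w \<le> (if ennreal w \<le> f 0 s then 0 else 1)"
      unfolding V_def by (rule cINF_lower[OF V_bdd Q(3)])
    then show "V s w \<le> 1" by (auto split: if_splits)
  qed
  have f_meas'[measurable]: "q \<in> Q \<Longrightarrow> f q \<in> borel_measurable borel" for q
    using f_meas Q by auto
  have V_meas: "(\<lambda>p. (fst p, V (fst p) (snd p))) \<in> measurable (unif \<Otimes>\<^sub>M L) borel"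
    unfolding V_def borel_prod[symmetric] using Q V_bdd
    by (intro measurable_Pair borel_measurable_cINF) measurable
  define P where "P = distr (unif \<Otimes>\<^sub>M L) borel (\<lambda>p. (fst p, V (fst p) (snd p)))"
  \<comment> \<open>Almost every slice of \<open>E u q\<close> has \<open>L\<close>-measure
    \<open>f q s\<close>, so its total mass is \<open>C u q\<close>. The event that the quantile is
    at most \<open>v\<close> contains \<open>E u q\<close> for \<open>q \<le> v\<close> and lies in
    it, up to a null set, for \<open>q > v\<close>.\<close>
  define E where "E u q = {p. fst p \<in> {0..u} \<and> ennreal (snd p) \<le> f q (fst p)}" for u q
  have E_sets: "E u q \<in> sets (unif \<Otimes>\<^sub>M L)" if [measurable]: "q \<in> Q" for u q
  proof -
    have "E u q = {p \<in> space (unif \<Otimes>\<^sub>M L). fst p \<in> {0..u} \<and> ennreal (snd p) \<le> f q (fst p)}"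
      by (auto simp: E_def space_pair_measure L_def)
    also have "\<dots> \<in> sets (unif \<Otimes>\<^sub>M L)" by measurable
    finally show ?thesis .
  qed
  have E_measure: "emeasure (unif \<Otimes>\<^sub>M L) (E u q) = ennreal (C u q)" if "u \<in> {0..1}" "q \<in> Q" for u q
  proof -
    have "AE s in unif. f q s \<le> f 1 s" using f_mono[of q 1] that Q by auto
    then have AE: "AE s in unif. emeasure L (Pair s -` E u q) = f q s * indicator {0..u} s"
    proof eventually_elim
      case (elim s)
      then have "f q s \<le> 1" by (simp add: f_one)
      then obtain y where y: "f q s = ennreal y" "0 \<le> y" "y \<le> 1"
        by (metis ennreal_cases ennreal_le_1 ennreal_one_neq_top top.extremum_unique top_neq_ennreal)
      then have "Pair s -` E u q = (if s \<in> {0..u} then {..y} else {})"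
        by (auto simp: E_def ennreal_le_iff2)
      then show ?case using L_below y by auto
    qed
    have "emeasure (unif \<Otimes>\<^sub>M L) (E u q) = (\<integral>\<^sup>+s. emeasure L (Pair s -` E u q) \<partial>unif)"
      by (rule L.emeasure_pair_measure_alt[OF E_sets[OF that(2)]])
    also have "\<dots> = (\<integral>\<^sup>+s\<in>{0..u}. f q s \<partial>unif)"
      using AE by (rule nn_integral_cong_AE)
    also have "\<dots> = ennreal (C u q)"
      using that Q f_int by auto
    finally show ?thesis .
  qed
  show thesis
  proof (rule that[of P])
    show "sets P = sets borel" by (simp add: P_def)
    fix u v :: real assume u: "u \<in> {0..1}" and v: "v \<in> {0..1}"
    define B where "B = {p. fst p \<in> {0..u} \<and> V (fst p) (snd p) \<le> v}"
    have "{0..u} \<times> {0..v} \<in> sets borel" by (intro borel_closed closed_Times) auto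
    with V_meas have B_sets: "B \<in> sets (unif \<Otimes>\<^sub>M L)"
      and P_B: "emeasure P ({0..u} \<times> {0..v}) = emeasure (unif \<Otimes>\<^sub>M L) B"
      using V_range measurable_sets[OF V_meas, of "{0..u} \<times> {0..v}"]
      by (auto simp: P_def emeasure_distr B_def vimage_def Int_def space_pair_measure L_def)
    have lower: "ennreal (C u q) \<le> emeasure (unif \<Otimes>\<^sub>M L) B" if "q \<in> Q" "q \<le> v" for q
      using E_measure[OF u that(1)] V_le[OF that(1)] that(2) B_sets
      by (auto simp: E_def B_def intro!: emeasure_mono dest!: sym[of "emeasure _ _"]) (meson order_trans)
    have trivial: "emeasure (unif \<Otimes>\<^sub>M L) B \<le> ennreal u"
    proof -
      have "emeasure (unif \<Otimes>\<^sub>M L) B \<le> emeasure (unif \<Otimes>\<^sub>M L) ({0..u} \<times> UNIV)"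
        by (intro emeasure_mono) (auto simp: B_def L_sets)
      also have "\<dots> = ennreal u"
        using u by (subst L.emeasure_pair_measure_Times) (auto simp: L_sets L_UNIV emeasure_unif_Icc)
      finally show ?thesis .
    qed
    \<comment> \<open>An infimum strictly below \<open>q\<close> is witnessed by a level
      \<open>r < q\<close>; this is where \<open>v < q\<close> is used. Monotonicity off a null set
      then passes from \<open>r\<close> to \<open>q\<close>.\<close>
    have upper: "emeasure (unif \<Otimes>\<^sub>M L) B \<le> ennreal (C u q)" if q: "q \<in> Q" and less: "v < q" for q
    proof -
      obtain N where N: "N \<in> null_sets unif" "{s. \<not> (\<forall>r\<in>Q. \<forall>q\<in>Q. r \<le> q \<longrightarrow> f r s \<le> f q s)} \<subseteq> N"
        using AE_mono unfolding eventually_ae_filter by auto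
      have N_null: "N \<times> UNIV \<in> null_sets (unif \<Otimes>\<^sub>M L)"
        using N(1) L.emeasure_pair_measure_Times[of N unif UNIV] by (auto simp: null_sets_def L_sets)
      have "f r (fst p) \<le> f q (fst p)" if "p \<notin> N \<times> UNIV" "r \<in> Q" "q \<in> Q" "r \<le> q" for p r q
      proof (rule ccontr)
        assume "\<not> f r (fst p) \<le> f q (fst p)"
        then have "fst p \<in> N" using that N(2) by blast
        with that(1) show False by (simp add: mem_Times_iff)
      qed
      then have "AE p in unif \<Otimes>\<^sub>M L. \<forall>r\<in>Q. \<forall>q\<in>Q. r \<le> q \<longrightarrow> f r (fst p) \<le> f q (fst p)"
        by (intro AE_I'[OF N_null]) blast
      then have "AE p in unif \<Otimes>\<^sub>M L. p \<in> B \<longrightarrow> p \<in> E u q"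
      proof eventually_elim
        case (elim p)
        show ?case
        proof
          assume p: "p \<in> B"
          with less have "V (fst p) (snd p) < q" by (auto simp: B_def)
          then obtain r where r: "r \<in> Q" "ennreal (snd p) \<le> f r (fst p)" "r < q"
            using q Q by (auto simp: V_less)
          with elim q have "f r (fst p) \<le> f q (fst p)" by auto
          with r p show "p \<in> E u q" by (auto simp: E_def B_def)
        qed
      qed
      then have "emeasure (unif \<Otimes>\<^sub>M L) B \<le> emeasure (unif \<Otimes>\<^sub>M L) (E u q)"
        using E_sets[OF q] by (rule emeasure_mono_AE)
      with E_measure[OF u q] show ?thesis by simp
    qed
    obtain b where b: "emeasure (unif \<Otimes>\<^sub>M L) B = ennreal b" "0 \<le> b"
      using trivial by (metis ennreal_cases ennreal_neq_top top.extremum_unique)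
    have "b = C u v"
    proof (rule antisym; rule field_le_epsilon)
      fix e :: real assume e: "0 < e"
      show "C u v \<le> b + e"
      proof -
        obtain q where "q \<in> Q" "v - e \<le> q" "q \<le> v" using rat_between_unit[OF v e] Q_def by auto
        then show ?thesis
          using lower[of q] b copula_increment_right[OF C, of u q v] u v Q by auto
      qed
      show "b \<le> C u v + e"
      \<comment> \<open>No level of \<open>Q\<close> lies above 1, so there the marginal bound
        \<open>u = C u 1\<close> replaces the approximation from above.\<close>
      proof (cases "v = 1")
        case True
        then show ?thesis using trivial b u e copula_one[OF C u] by simp
      next
        case False
        then have "v < min 1 (v + e)" using v e by auto
        then obtain q where q: "q \<in> \<rat>" "v < q" "q < min 1 (v + e)" using Rats_dense_in_real by blast
        then have "q \<in> Q" using v by (auto simp: Q_def)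
        then show ?thesis
          using upper[of q] q b copula_increment_right[OF C, of u v q] copula_bounds(1)[OF C u, of q] u v
          by (auto simp: ennreal_le_iff)
      qed
    qed
    with b P_B show "emeasure P ({0..u} \<times> {0..v}) = ennreal (C u v)" by simp
  qed
qed

section \<open>The measure \<open>copula_measure\<close> and its survival function\<close>

lemma sets_copula_measure:
  "sets (copula_measure C) = sigma_sets ({0..1} \<times> {0..1}) ((\<lambda>(u, v). {0..u} \<times> {0..v}) ` ({0..1} \<times> {0..1}))"
  unfolding copula_measure_def by (rule sets_extend_measure) auto

lemma space_copula_measure: "space (copula_measure C) = {0..1} \<times> {0..1}"
  unfolding copula_measure_def by (rule space_extend_measure) auto

text \<open>An extension takes the prescribed values as soon as one measure realises them. The
  witness is the Borel measure above, restricted to the sigma-algebra generated by the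
  boxes.\<close>

lemma emeasure_copula_measure:
  assumes C: "copula C" and uv: "u \<in> {0..1}" "v \<in> {0..1}"
  shows "emeasure (copula_measure C) ({0..u} \<times> {0..v}) = ennreal (C u v)"
proof -
  obtain P :: "(real \<times> real) measure" where P: "sets P = sets borel"
    "\<And>u v. u \<in> {0..1} \<Longrightarrow> v \<in> {0..1} \<Longrightarrow> emeasure P ({0..u} \<times> {0..v}) = ennreal (C u v)"
    using copula_borel_measure_exists[OF C] by blast
  have box: "{0..u} \<times> {0..v} \<in> sets P" for u v :: real
    unfolding P by (intro borel_closed closed_Times) auto
  have "A \<in> sets P" if "A \<in> sets (copula_measure C)" for A
    using that unfolding sets_copula_measure
  proof induction
    case (Basic a)
    then show ?case using box by auto
  next
    case (Compl a)
    then show ?case using box[of 1 1] by auto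
  qed auto
  then have sub: "sets (copula_measure C) \<subseteq> sets P" by blast
  have "countably_additive (sets (copula_measure C)) (emeasure P)"
    using sub by (intro countably_additiveI suminf_emeasure) auto
  moreover have "(\<lambda>(u, v). {0..u} \<times> {0..v}) ` ({0..1} \<times> {0..1}) \<subseteq> Pow ({0..1 :: real} \<times> {0..1 :: real})"
    by auto
  ultimately show ?thesis
    using emeasure_extend_measure[OF copula_measure_def, of "emeasure P" C "(u, v)"] P uv
    by (auto simp: positive_def)
qed

lemma copula_box_sets: "u \<in> {0..1} \<Longrightarrow> v \<in> {0..1} \<Longrightarrow> {0..u} \<times> {0..v} \<in> sets (copula_measure C)"
  unfolding sets_copula_measure by (intro sigma_sets.Basic) auto

lemma finite_measure_copula: "copula C \<Longrightarrow> finite_measure (copula_measure C)"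
  using emeasure_copula_measure[of C 1 1]
  by (intro finite_measureI) (simp add: space_copula_measure)

lemma measurable_copula_measure[measurable]:
  "fst \<in> borel_measurable (copula_measure C)" "snd \<in> borel_measurable (copula_measure C)"
proof -
  have "{p :: real \<times> real. p \<in> {0..1} \<times> {0..1} \<and> fst p \<le> a} \<in> sets (copula_measure C) \<and>
    {p :: real \<times> real. p \<in> {0..1} \<times> {0..1} \<and> snd p \<le> a} \<in> sets (copula_measure C)" for a :: real
  proof (cases "a < 0")
    case True
    then have "{p :: real \<times> real. p \<in> {0..1} \<times> {0..1} \<and> fst p \<le> a} = {}" "{p :: real \<times> real. p \<in> {0..1} \<times> {0..1} \<and> snd p \<le> a} = {}"
      by auto
    then show ?thesis by (simp only: sets.empty_sets)
  next
    case False
    then have "{p :: real \<times> real. p \<in> {0..1} \<times> {0..1} \<and> fst p \<le> a} = {0..min a 1} \<times> {0..1}"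
      "{p :: real \<times> real. p \<in> {0..1} \<times> {0..1} \<and> snd p \<le> a} = {0..1} \<times> {0..min a 1}"
      by auto
    then show ?thesis
      using False copula_box_sets[of "min a 1" 1] copula_box_sets[of 1 "min a 1"] by simp
  qed
  then show "fst \<in> borel_measurable (copula_measure C)" "snd \<in> borel_measurable (copula_measure C)"
    by (simp_all add: borel_measurable_iff_le space_copula_measure conj_assoc)
qed

text \<open>Strict inequalities make the complement a union of two closed boxes, to which
  inclusion-exclusion applies.\<close>

lemma emeasure_copula_survival:
  assumes C: "copula C" and ts: "t \<in> {0..1}" "s \<in> {0..1}"
  shows "emeasure (copula_measure C) {p \<in> space (copula_measure C). t < fst p \<and> s < snd p} =
    ennreal (1 - t - s + C t s)"
proof -
  let ?M = "copula_measure C"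
  interpret finite_measure ?M by (rule finite_measure_copula[OF C])
  have box: "{0..u} \<times> {0..v} \<in> sets ?M" "measure ?M ({0..u} \<times> {0..v}) = C u v"
    if "u \<in> {0..1}" "v \<in> {0..1}" for u v
    using that emeasure_copula_measure[OF C that] copula_bounds(1)[OF C that]
    by (auto simp: copula_box_sets measure_def)
  have "{p \<in> space ?M. t < fst p \<and> s < snd p} =
    ({0..1} \<times> {0..1}) - (({0..t} \<times> {0..1}) \<union> ({0..1} \<times> {0..s}))"
    using ts by (auto simp: space_copula_measure)
  also have "measure ?M \<dots> = 1 - measure ?M (({0..t} \<times> {0..1}) \<union> ({0..1} \<times> {0..s}))"
    using ts box[of 1 1] box[of t 1] box[of 1 s] copula_one[OF C, of 1]
    by (subst finite_measure_Diff) auto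
  also have "measure ?M (({0..t} \<times> {0..1}) \<union> ({0..1} \<times> {0..s})) =
    measure ?M ({0..t} \<times> {0..1}) + measure ?M ({0..1} \<times> {0..s}) - measure ?M (({0..t} \<times> {0..1}) \<inter> ({0..1} \<times> {0..s}))"
    using ts box[of t 1] box[of 1 s] by (intro measure_Un3) (auto simp: fmeasurable_eq_sets)
  also have "({0..t} \<times> {0..1}) \<inter> ({0..1} \<times> {0..s}) = {0..t} \<times> {0..s}"
    using ts by auto
  finally show ?thesis
    using ts box[of t 1] box[of 1 s] box[of t s] copula_one[OF C, of t] copula_one[OF C, of s]
    by (simp add: emeasure_eq_measure diff_diff_eq[symmetric]) (simp add: algebra_simps)
qed

section \<open>Gini's gamma as an integral over the diagonals\<close>

text \<open>Layer cake: both \<open>min u v\<close> and \<open>max 0 (u + v - 1)\<close> are the length of a set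
  \<open>{t. t < u \<and> \<sigma> t < v}\<close>, with \<open>\<sigma> t = t\<close> and \<open>\<sigma> t = 1 - t\<close>.\<close>

lemma integral_copula_layer:
  fixes h :: "real \<times> real \<Rightarrow> real"
  assumes C: "copula C"
    and \<sigma>: "continuous_on UNIV \<sigma>" "\<And>t. t \<in> {0..1} \<Longrightarrow> \<sigma> t \<in> {0..1}"
    and h[measurable]: "h \<in> borel_measurable (copula_measure C)"
    and h_layer: "\<And>p. p \<in> {0..1} \<times> {0..1} \<Longrightarrow> 0 \<le> h p \<and>
      emeasure lborel {t \<in> {0..1}. t < fst p \<and> \<sigma> t < snd p} = ennreal (h p)"
  shows "(\<integral>p. h p \<partial>copula_measure C) = integral {0..1} (\<lambda>t. 1 - t - \<sigma> t + C t (\<sigma> t))"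
proof -
  let ?M = "copula_measure C"
  interpret M: finite_measure ?M by (rule finite_measure_copula[OF C])
  interpret pair_sigma_finite lborel ?M ..
  have [measurable]: "\<sigma> \<in> borel_measurable borel"
    using \<sigma>(1) by (rule borel_measurable_continuous_onI)
  define g where "g t = 1 - t - \<sigma> t + C t (\<sigma> t)" for t
  have g_nonneg: "0 \<le> g t" if "t \<in> {0..1}" for t
    using copula_bounds(2)[OF C that \<sigma>(2)[OF that]] by (simp add: g_def)
  have "continuous_on {0..1} g"
    unfolding g_def using \<sigma> by (intro continuous_intros copula_continuous_compose[OF C])
      (auto intro: continuous_on_subset)
  then have g_int: "set_integrable lborel {0..1} g" by (rule borel_integrable_atLeastAtMost')
  have "(\<integral>p. h p \<partial>?M) = enn2real (\<integral>\<^sup>+p. ennreal (h p) \<partial>?M)"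
    using h_layer by (intro integral_eq_nn_integral) (auto simp: space_copula_measure)
  also have "(\<integral>\<^sup>+p. ennreal (h p) \<partial>?M) =
      (\<integral>\<^sup>+p. \<integral>\<^sup>+t. (if t \<in> {0..1} \<and> t < fst p \<and> \<sigma> t < snd p then 1 else 0) \<partial>lborel \<partial>?M)"
  proof (rule nn_integral_cong)
    fix p assume "p \<in> space ?M"
    then have "ennreal (h p) = emeasure lborel {t \<in> space lborel. t \<in> {0..1} \<and> t < fst p \<and> \<sigma> t < snd p}"
      using h_layer[of p] by (simp add: space_copula_measure)
    also have "\<dots> = (\<integral>\<^sup>+t. indicator {t \<in> space lborel. t \<in> {0..1} \<and> t < fst p \<and> \<sigma> t < snd p} t \<partial>lborel)"
      by (rule nn_integral_indicator[symmetric]) measurable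
    finally show "ennreal (h p) =
      (\<integral>\<^sup>+t. (if t \<in> {0..1} \<and> t < fst p \<and> \<sigma> t < snd p then 1 else 0) \<partial>lborel)"
      by (auto intro!: nn_integral_cong split: split_indicator simp del: nn_integral_indicator)
  qed
  also have "\<dots> =
      (\<integral>\<^sup>+t. \<integral>\<^sup>+p. (if t \<in> {0..1} \<and> t < fst p \<and> \<sigma> t < snd p then 1 else 0) \<partial>?M \<partial>lborel)"
    by (rule Fubini') measurable
  \<comment> \<open>For fixed \<open>t\<close> the inner integral is the survival probability at
    \<open>(t, \<sigma> t)\<close>.\<close>
  also have "\<dots> = (\<integral>\<^sup>+t. ennreal (indicator {0..1} t * g t) \<partial>lborel)"
  proof (rule nn_integral_cong)
    fix t :: real
    have "(\<integral>\<^sup>+p. (if t \<in> {0..1} \<and> t < fst p \<and> \<sigma> t < snd p then 1 else 0) \<partial>?M) =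
      (\<integral>\<^sup>+p. indicator {0..1} t * indicator {p \<in> space ?M. t < fst p \<and> \<sigma> t < snd p} p \<partial>?M)"
      by (intro nn_integral_cong) (auto split: split_indicator)
    also have "\<dots> = indicator {0..1} t * emeasure ?M {p \<in> space ?M. t < fst p \<and> \<sigma> t < snd p}"
      by (rule nn_integral_cmult_indicator) measurable
    also have "\<dots> = ennreal (indicator {0..1} t * g t)"
      using emeasure_copula_survival[OF C _ \<sigma>(2), of t t] by (auto simp: g_def split: split_indicator)
    finally show "(\<integral>\<^sup>+p. (if t \<in> {0..1} \<and> t < fst p \<and> \<sigma> t < snd p then 1 else 0) \<partial>?M) =
      ennreal (indicator {0..1} t * g t)" .
  qed
  also have "enn2real \<dots> = (\<integral>t. indicator {0..1} t * g t \<partial>lborel)"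
    using g_int g_nonneg
    by (intro integral_eq_nn_integral[symmetric]) (auto simp: set_integrable_def split: split_indicator)
  also have "\<dots> = integral {0..1} g"
    using set_borel_integral_eq_integral(2)[OF g_int] by (simp add: set_lebesgue_integral_def)
  finally show ?thesis unfolding g_def .
qed

definition gini_integral :: "(real \<Rightarrow> real \<Rightarrow> real) \<Rightarrow> real" where
  "gini_integral C = integral {0..1} (\<lambda>t. C t t) + integral {0..1} (\<lambda>t. C t (1 - t))"

lemma copula_integrable:
  assumes "copula C"
  shows "(\<lambda>t. C t t) integrable_on {0..1}" "(\<lambda>t. C t (1 - t)) integrable_on {0..1}"
  by (intro integrable_continuous_real copula_continuous_compose[OF assms];
      auto intro!: continuous_on_diff continuous_on_const continuous_on_id)+

text \<open>The linear part of the layer formula is \<open>1 - 2 * t\<close>, of mean zero, for M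
  and cancels pointwise for W. Only the two sections of \<open>C\<close> remain.\<close>

lemma gini_gamma_eq:
  assumes C: "copula C"
  shows "gini_gamma C = 4 * gini_integral C - 2"
proof -
  have "(\<integral>p. copula_M (fst p) (snd p) \<partial>copula_measure C) = integral {0..1} (\<lambda>t. 1 - t - t + C t t)"
  proof (rule integral_copula_layer[OF C])
    show "(\<lambda>p. copula_M (fst p) (snd p)) \<in> borel_measurable (copula_measure C)"
      unfolding copula_M_def by measurable
    fix p :: "real \<times> real" assume p: "p \<in> {0..1} \<times> {0..1}"
    then have *: "0 \<le> min (fst p) (snd p)"
      "{t \<in> {0..1}. t < fst p \<and> t < snd p} = {0..<min (fst p) (snd p)}" by auto
    from *(1) show "0 \<le> copula_M (fst p) (snd p) \<and>
        emeasure lborel {t \<in> {0..1}. t < fst p \<and> t < snd p} = ennreal (copula_M (fst p) (snd p))"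
      unfolding *(2) copula_M_def by simp
  qed auto
  also have "\<dots> = integral {0..1} (\<lambda>t. 1 - 2 * t) + integral {0..1} (\<lambda>t. C t t)"
    using copula_integrable[OF C]
    by (subst integral_add[symmetric]) (auto intro!: integrable_continuous_real continuous_intros simp: algebra_simps)
  also have "integral {0..1} (\<lambda>t. 1 - 2 * t :: real) = 0"
    using has_integral_diff[OF has_integral_const_real[of "1 :: real" 0 1]
        has_integral_mult_right[OF ident_has_integral[of 0 "1 :: real"], of 2]]
    by (intro integral_unique) simp
  finally have M: "(\<integral>p. copula_M (fst p) (snd p) \<partial>copula_measure C) = integral {0..1} (\<lambda>t. C t t)"
    by simp
  have "(\<integral>p. copula_W (fst p) (snd p) \<partial>copula_measure C) =
      integral {0..1} (\<lambda>t. 1 - t - (1 - t) + C t (1 - t))"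
  proof (rule integral_copula_layer[OF C])
    show "(\<lambda>p. copula_W (fst p) (snd p)) \<in> borel_measurable (copula_measure C)"
      unfolding copula_W_def by measurable
    fix p :: "real \<times> real" assume p: "p \<in> {0..1} \<times> {0..1}"
    then have *: "{t \<in> {0..1}. t < fst p \<and> 1 - t < snd p} = {1 - snd p<..<fst p}" by auto
    show "0 \<le> copula_W (fst p) (snd p) \<and>
        emeasure lborel {t \<in> {0..1}. t < fst p \<and> 1 - t < snd p} = ennreal (copula_W (fst p) (snd p))"
      unfolding * copula_W_def by (cases "1 - snd p \<le> fst p") (auto simp: max_def algebra_simps)
  qed (auto intro!: continuous_intros)
  with M show ?thesis
    by (simp add: gini_gamma_def concordance_def gini_integral_def)
qed

section \<open>The bounds\<close>

abbreviation ramp :: "real \<Rightarrow> real \<Rightarrow> real" where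
  "ramp c t \<equiv> max 0 (t - c)"

text \<open>The piecewise linear bounds below are rewritten as combinations of hinges, so this
  formula yields their integrals. With the arguments swapped, \<open>ramp t c\<close> is the hinge
  that descends to zero at \<open>c\<close>.\<close>

lemma ramp_has_integral:
  assumes "0 \<le> c" "c \<le> 1"
  shows "(ramp c has_integral (1 - c)\<^sup>2 / 2) {0..1}"
proof -
  have "(ramp c has_integral 0) {0..c}"
    by (rule has_integral_is_0) auto
  moreover have "(ramp c has_integral (1 - c)\<^sup>2 / 2) {c..1}"
  proof (rule has_integral_eq[of _ "\<lambda>t. t - c"])
    have "((\<lambda>t. t - c) has_integral ((1 - c)\<^sup>2 / 2 - (c - c)\<^sup>2 / 2)) {c..1}"
      using assms(2)
      by (intro fundamental_theorem_of_calculus)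
        (auto simp flip: has_real_derivative_iff_has_vector_derivative intro!: derivative_eq_intros)
    then show "((\<lambda>t. t - c) has_integral (1 - c)\<^sup>2 / 2) {c..1}" by simp
  qed auto
  ultimately show ?thesis
    using has_integral_combine[OF assms] by fastforce
qed

lemma id_has_integral_unit: "((\<lambda>t::real. t) has_integral 1 / 2) {0..1}"
  using ident_has_integral[of 0 "1 :: real"] by simp

lemma reflect_unit_has_integral:
  fixes f :: "real \<Rightarrow> real"
  assumes "(f has_integral i) {0..1}"
  shows "((\<lambda>t. f (1 - t)) has_integral i) {0..1}"
  using has_integral_affinity[of f i 0 1 "-1" 1] assms
  by (simp add: cbox_interval)

text \<open>Transposition fixes the main diagonal and reverses the direction of the
  antidiagonal.\<close>

lemma gini_integral_transpose:
  "copula C \<Longrightarrow> gini_integral (\<lambda>u v. C v u) = gini_integral C"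
  using reflect_unit_has_integral[OF integrable_integral[OF copula_integrable(2)], of C]
  by (simp add: gini_integral_def integral_unique)

text \<open>Since \<open>C a b \<le> a\<close>, the bounds \<open>C b a \<ge> 0\<close> and
  \<open>C b a \<ge> a + b - 1\<close> give \<open>m \<le> a\<close> and
  \<open>m \<le> 1 - b\<close>. Comparing both values with \<open>C a a\<close> gives
  \<open>m \<le> b - a\<close>. The three gaps add up to 1, whence
  \<open>m \<le> 1/3\<close>.\<close>

lemma copula_asymmetry_constraints:
  assumes C: "copula C" and ab: "a \<in> {0..1}" "b \<in> {0..1}" "a \<le> b" and m: "C a b = C b a + m"
  shows "m \<le> a" "a \<le> b - m" "b \<le> 1 - m" "C b a \<le> a - m"
  using copula_bounds[OF C ab(1,2)] copula_bounds[OF C ab(2,1)] m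
    copula_increment_right(2)[OF C, of a a b] copula_increment_left(1)[OF C, of a b a] ab
  by auto

text \<open>For t between a and b the estimate from (a,b) is \<open>C b a + m - (b - t)\<close>;
  inserting \<open>C b a \<ge> a + b - 1\<close> and \<open>a \<ge> m\<close> leaves the line
  \<open>t - 1 + 2 * m\<close>, free of a and b. On the antidiagonal the same estimate dominates a
  tent of height m at a.\<close>

lemma gini_diagonal_lower:
  assumes C: "copula C" and ab: "a \<in> {0..1}" "b \<in> {0..1}" "a \<le> b" and m: "C a b = C b a + m" "0 \<le> m"
    and t: "t \<in> {0..1}"
  shows "max (max 0 (2 * t - 1)) (t - 1 + 2 * m) \<le> C t t" (is ?diag)
    and "max 0 (m - \<bar>t - a\<bar>) \<le> C t (1 - t)" (is ?anti)
proof -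
  have t': "1 - t \<in> {0..1}" using t by auto
  note constraints = copula_asymmetry_constraints[OF C ab m(1)] copula_bounds(1,2)[OF C ab(2,1)]
  have "C b a + m \<le> C t t + ramp t a + ramp t b"
    using copula_mono_lipschitz[OF C, of a b t t] ab t m by auto
  then show ?diag
    using constraints copula_bounds(1,2)[OF C t t] ab m(2) by (auto simp: max_def split: if_splits)
  have "C b a + m \<le> C t (1 - t) + ramp t a + ramp (1 - t) b"
    using copula_mono_lipschitz[OF C, of a b t "1 - t"] ab t t' m by auto
  then show ?anti
    using constraints copula_bounds(1)[OF C t t'] ab m(2) by (auto simp: max_def abs_if split: if_splits)
qed

text \<open>The main diagonal bound is the minimum of t and
  \<open>a - m + ramp a t + ramp b t\<close>, with successive slopes 1, 0, 1, 2, 1. On the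
  antidiagonal the estimate from (b,a) is enlarged, by \<open>C b a \<le> a - m\<close> and the gap
  conditions, to the one from value 0 at (2m, m).\<close>

lemma gini_diagonal_upper:
  assumes C: "copula C" and ab: "a \<in> {0..1}" "b \<in> {0..1}" "a \<le> b" and m: "C a b = C b a + m" "0 \<le> m"
    and t: "t \<in> {0..1}"
  shows "C t t \<le> t - ramp (a - m) t + ramp a t + ramp b t - ramp (b + m) t" (is ?diag)
    and "C t (1 - t) \<le> min (min t (1 - t)) (ramp (2 * m) t + ramp t (1 - m))" (is ?anti)
proof -
  have t': "1 - t \<in> {0..1}" using t by auto
  note constraints = copula_asymmetry_constraints[OF C ab m(1)] copula_bounds(1,2)[OF C ab(2,1)]
  have "C t t \<le> C b a + ramp b t + ramp a t"
    using copula_mono_lipschitz[OF C, of t t b a] ab t by auto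
  then show ?diag
    using constraints copula_bounds(3)[OF C t t] ab m(2) by (auto simp: max_def split: if_splits)
  have "C t (1 - t) \<le> C b a + ramp b t + ramp a (1 - t)"
    using copula_mono_lipschitz[OF C, of t "1 - t" b a] ab t t' by auto
  then show ?anti
    using constraints copula_bounds(3,4)[OF C t t'] ab m(2) by (auto simp: max_def split: if_splits)
qed

section \<open>Integrals of the bounding functions\<close>

lemma diag_lower_has_integral:
  assumes "0 \<le> m" "m \<le> 1/3"
  shows "((\<lambda>t. max (max 0 (2 * t - 1)) (t - 1 + 2 * m)) has_integral
    (gamma_lower m + 2) / 4 - m\<^sup>2) {0..1}"
proof (cases "m \<le> 1/4")
  case True
  \<comment> \<open>Up to 1/4 the line \<open>t - 1 + 2 * m\<close> does not rise above the kink of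
    \<open>max 0 (2 * t - 1)\<close> at 1/2.\<close>
  have "((\<lambda>t. 2 * ramp (1/2) t) has_integral 2 * ((1 - 1/2)\<^sup>2 / 2)) {0..1}"
    by (intro has_integral_mult_right ramp_has_integral) auto
  then have "((\<lambda>t. max (max 0 (2 * t - 1)) (t - 1 + 2 * m)) has_integral 2 * ((1 - 1/2)\<^sup>2 / 2)) {0..1}"
    by (rule has_integral_eq[rotated]) (use True in \<open>auto simp: max_def\<close>)
  also have "2 * ((1 - 1/2)\<^sup>2 / 2) = (gamma_lower m + 2) / 4 - m\<^sup>2"
    using True by (simp add: gamma_lower_def power2_eq_square field_simps)
  finally show ?thesis .
next
  case False
  \<comment> \<open>Beyond 1/4 the line leaves zero at \<open>1 - 2 * m\<close> and meets
    \<open>2 * t - 1\<close> at \<open>2 * m\<close>.\<close>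
  have "((\<lambda>t. ramp (1 - 2 * m) t + ramp (2 * m) t) has_integral
      (1 - (1 - 2 * m))\<^sup>2 / 2 + (1 - 2 * m)\<^sup>2 / 2) {0..1}"
    using assms by (intro has_integral_add ramp_has_integral) auto
  then have "((\<lambda>t. max (max 0 (2 * t - 1)) (t - 1 + 2 * m)) has_integral
      (1 - (1 - 2 * m))\<^sup>2 / 2 + (1 - 2 * m)\<^sup>2 / 2) {0..1}"
    by (rule has_integral_eq[rotated]) (use False in \<open>auto simp: max_def\<close>)
  also have "(1 - (1 - 2 * m))\<^sup>2 / 2 + (1 - 2 * m)\<^sup>2 / 2 = (gamma_lower m + 2) / 4 - m\<^sup>2"
    using False by (simp add: gamma_lower_def power2_eq_square field_simps)
  finally show ?thesis .
qed

text \<open>The area does not depend on the centre a. It restores the m^2 subtracted in the main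
  diagonal integral.\<close>

lemma tent_has_integral:
  fixes a m :: real
  assumes "0 \<le> m" "m \<le> a" "a \<le> 1 - m"
  shows "((\<lambda>t. max 0 (m - \<bar>t - a\<bar>)) has_integral m\<^sup>2) {0..1}"
proof -
  have "((\<lambda>t. ramp (a - m) t - 2 * ramp a t + ramp (a + m) t) has_integral
      (1 - (a - m))\<^sup>2 / 2 - 2 * ((1 - a)\<^sup>2 / 2) + (1 - (a + m))\<^sup>2 / 2) {0..1}"
    using assms by (intro has_integral_add has_integral_diff has_integral_mult_right ramp_has_integral) auto
  then have "((\<lambda>t. max 0 (m - \<bar>t - a\<bar>)) has_integral
      (1 - (a - m))\<^sup>2 / 2 - 2 * ((1 - a)\<^sup>2 / 2) + (1 - (a + m))\<^sup>2 / 2) {0..1}"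
    by (rule has_integral_eq[rotated]) (use assms in \<open>auto simp: max_def abs_if\<close>)
  also have "(1 - (a - m))\<^sup>2 / 2 - 2 * ((1 - a)\<^sup>2 / 2) + (1 - (a + m))\<^sup>2 / 2 = m\<^sup>2"
    by (simp add: power2_eq_square field_simps)
  finally show ?thesis .
qed

lemma diag_upper_has_integral:
  fixes a b m :: real
  assumes "0 \<le> m" "m \<le> a" "a \<le> b - m" "b \<le> 1 - m"
  shows "((\<lambda>t. t - ramp (a - m) t + ramp a t + ramp b t - ramp (b + m) t) has_integral
    1 / 2 - m * (b - a) - m\<^sup>2) {0..1}"
proof -
  have "((\<lambda>t. t - ramp (a - m) t + ramp a t + ramp b t - ramp (b + m) t) has_integral
      1 / 2 - (1 - (a - m))\<^sup>2 / 2 + (1 - a)\<^sup>2 / 2 + (1 - b)\<^sup>2 / 2 - (1 - (b + m))\<^sup>2 / 2) {0..1}"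
    using assms by (intro has_integral_add has_integral_diff id_has_integral_unit ramp_has_integral) auto
  also have "1 / 2 - (1 - (a - m))\<^sup>2 / 2 + (1 - a)\<^sup>2 / 2 + (1 - b)\<^sup>2 / 2 - (1 - (b + m))\<^sup>2 / 2 =
      1 / 2 - m * (b - a) - m\<^sup>2"
    by (simp add: power2_eq_square field_simps)
  finally show ?thesis .
qed

text \<open>The second function is a valley with floor \<open>1 - 3 * m\<close> on [2m, 1-m] and
  slopes -1 and 1 outside; the first is the tent with peak 1/2. The floor drops below the peak at m
  = 1/6. The falling branch cuts the tent, at (1-m)/2, from m = 1/5 on, and the rising branch, at m
  + 1/2, from m = 1/4 on.\<close>

lemma anti_upper_has_integral:
  assumes m: "0 \<le> m" "m \<le> 1/3"
  shows "((\<lambda>t. min (min t (1 - t)) (ramp (2 * m) t + ramp t (1 - m))) has_integral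
    gamma_upper m / 4 + 2 * m\<^sup>2) {0..1}" (is "(?f has_integral ?i) _")
proof -
  note intros = has_integral_add has_integral_diff has_integral_mult_right ramp_has_integral id_has_integral_unit
  consider "m \<le> 1/6" | "1/6 < m" "m \<le> 1/5" | "1/5 < m" "m \<le> 1/4" | "1/4 < m"
    by linarith
  then show ?thesis
  proof cases
    case 1
    have "((\<lambda>t. t - 2 * ramp (1/2) t) has_integral 1/2 - 2 * ((1 - 1/2)\<^sup>2 / 2)) {0..1}"
      by (intro intros) auto
    then have "(?f has_integral 1/2 - 2 * ((1 - 1/2)\<^sup>2 / 2)) {0..1}"
      by (rule has_integral_eq[rotated]) (use 1 m in \<open>auto simp: max_def min_def\<close>)
    also have "1/2 - 2 * ((1 - 1/2)\<^sup>2 / 2) = ?i"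
      using 1 by (simp add: gamma_upper_def power2_eq_square field_simps)
    finally show ?thesis .
  next
    case 2
    have "((\<lambda>t. t - ramp (1 - 3 * m) t - ramp (3 * m) t) has_integral
        1/2 - (1 - (1 - 3 * m))\<^sup>2 / 2 - (1 - 3 * m)\<^sup>2 / 2) {0..1}"
      using m by (intro intros) auto
    then have "(?f has_integral 1/2 - (1 - (1 - 3 * m))\<^sup>2 / 2 - (1 - 3 * m)\<^sup>2 / 2) {0..1}"
      by (rule has_integral_eq[rotated]) (use 2 m in \<open>auto simp: max_def min_def\<close>)
    also have "1/2 - (1 - (1 - 3 * m))\<^sup>2 / 2 - (1 - 3 * m)\<^sup>2 / 2 = ?i"
      using 2 by (simp add: gamma_upper_def power2_eq_square field_simps)
    finally show ?thesis .
  next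
    case 3
    have "((\<lambda>t. t - 2 * ramp (1/2 - m/2) t + ramp (2 * m) t - ramp (3 * m) t) has_integral
        1/2 - 2 * ((1 - (1/2 - m/2))\<^sup>2 / 2) + (1 - 2 * m)\<^sup>2 / 2 - (1 - 3 * m)\<^sup>2 / 2) {0..1}"
      using m by (intro intros) auto
    then have "(?f has_integral
        1/2 - 2 * ((1 - (1/2 - m/2))\<^sup>2 / 2) + (1 - 2 * m)\<^sup>2 / 2 - (1 - 3 * m)\<^sup>2 / 2) {0..1}"
      by (rule has_integral_eq[rotated]) (use 3 m in \<open>auto simp: max_def min_def\<close>)
    also have "1/2 - 2 * ((1 - (1/2 - m/2))\<^sup>2 / 2) + (1 - 2 * m)\<^sup>2 / 2 - (1 - 3 * m)\<^sup>2 / 2 = ?i"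
      using 3 by (simp add: gamma_upper_def power2_eq_square field_simps)
    finally show ?thesis .
  next
    case 4
    have "((\<lambda>t. t - 2 * ramp (1/2 - m/2) t + ramp (2 * m) t + ramp (1 - m) t - 2 * ramp (m + 1/2) t) has_integral
        1/2 - 2 * ((1 - (1/2 - m/2))\<^sup>2 / 2) + (1 - 2 * m)\<^sup>2 / 2 + (1 - (1 - m))\<^sup>2 / 2 - 2 * ((1 - (m + 1/2))\<^sup>2 / 2)) {0..1}"
      using m by (intro intros) auto
    then have "(?f has_integral
        1/2 - 2 * ((1 - (1/2 - m/2))\<^sup>2 / 2) + (1 - 2 * m)\<^sup>2 / 2 + (1 - (1 - m))\<^sup>2 / 2 - 2 * ((1 - (m + 1/2))\<^sup>2 / 2)) {0..1}"
      by (rule has_integral_eq[rotated]) (use 4 m in \<open>auto simp: max_def min_def\<close>)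
    also have "1/2 - 2 * ((1 - (1/2 - m/2))\<^sup>2 / 2) + (1 - 2 * m)\<^sup>2 / 2 + (1 - (1 - m))\<^sup>2 / 2 - 2 * ((1 - (m + 1/2))\<^sup>2 / 2) = ?i"
      using 4 by (simp add: gamma_upper_def power2_eq_square field_simps)
    finally show ?thesis .
  qed
qed

lemma gini_gamma_bounds:
  assumes C: "copula C" and ab: "a \<in> {0..1}" "b \<in> {0..1}" "a \<le> b" and m: "C a b = C b a + m" "0 \<le> m"
  shows "gini_gamma C \<in> {gamma_lower m..gamma_upper m}"
proof -
  note constraints = copula_asymmetry_constraints[OF C ab m(1)]
  have m_le: "m \<le> 1/3" and a: "a \<le> 1 - m" using constraints m(2) by auto
  note ints = copula_integrable[OF C, THEN integrable_integral]
  note lower = gini_diagonal_lower[OF C ab m] and upper = gini_diagonal_upper[OF C ab m]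
  have "(gamma_lower m + 2) / 4 - m\<^sup>2 \<le> integral {0..1} (\<lambda>t. C t t)"
    "m\<^sup>2 \<le> integral {0..1} (\<lambda>t. C t (1 - t))"
    using lower has_integral_le[OF diag_lower_has_integral[OF m(2) m_le] ints(1)]
      has_integral_le[OF tent_has_integral[OF m(2) constraints(1) a] ints(2)] by auto
  moreover have "integral {0..1} (\<lambda>t. C t t) \<le> 1 / 2 - m * (b - a) - m\<^sup>2"
    "integral {0..1} (\<lambda>t. C t (1 - t)) \<le> gamma_upper m / 4 + 2 * m\<^sup>2"
    using upper has_integral_le[OF ints(1) diag_upper_has_integral[OF m(2) constraints(1-3)]]
      has_integral_le[OF ints(2) anti_upper_has_integral[OF m(2) m_le]] by auto
  \<comment> \<open>The main diagonal majorant still depends on \<open>b - a\<close>. The smallest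
    gap m is the worst case, with integral 1/2 - 2 m^2, and the antidiagonal bound compensates the 2
    m^2.\<close>
  moreover have "m * m \<le> m * (b - a)"
    using constraints m(2) by (intro mult_left_mono) auto
  ultimately show ?thesis
    by (simp add: gini_gamma_eq[OF C] gini_integral_def power2_eq_square field_simps)
qed

section \<open>Evaluation of the asymmetry\<close>

lemma asymmetry_attained:
  assumes C: "copula C"
  obtains u v where "u \<in> {0..1}" "v \<in> {0..1}" "asymmetry C = \<bar>C u v - C v u\<bar>"
proof -
  let ?f = "\<lambda>p. \<bar>C (fst p) (snd p) - C (snd p) (fst p)\<bar>"
  have "continuous_on ({0..1} \<times> {0..1}) ?f"
    by (intro continuous_on_rabs continuous_on_diff copula_continuous_compose[OF C]
        continuous_on_fst continuous_on_snd continuous_on_id) auto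
  moreover have "compact ({0..1 :: real} \<times> {0..1 :: real})"
    by (intro compact_Times compact_Icc)
  ultimately obtain p where p: "p \<in> {0..1} \<times> {0..1}" "\<And>q. q \<in> {0..1} \<times> {0..1} \<Longrightarrow> ?f q \<le> ?f p"
    using continuous_attains_sup[of "{0..1} \<times> {0..1}" ?f] by auto
  have "asymmetry C = ?f p"
    unfolding asymmetry_def using p by (intro cSup_eq_maximum) auto
  with p that[of "fst p" "snd p"] show thesis by (auto simp: mem_Times_iff)
qed

text \<open>Exchanging u and v flips the sign of the difference, so a one-sided bound controls the
  absolute value.\<close>

lemma asymmetry_eqI:
  assumes "u \<in> {0..1}" "v \<in> {0..1}" "\<bar>C u v - C v u\<bar> = m"
    "\<And>u v. u \<in> {0..1} \<Longrightarrow> v \<in> {0..1} \<Longrightarrow> C u v - C v u \<le> m"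
  shows "asymmetry C = m"
  unfolding asymmetry_def
proof (rule cSup_eq_maximum)
  show "m \<in> (\<lambda>(u, v). \<bar>C u v - C v u\<bar>) ` ({0..1} \<times> {0..1})"
    using assms(1-3) by (intro image_eqI[of _ _ "(u, v)"]) auto
  fix x assume "x \<in> (\<lambda>(u, v). \<bar>C u v - C v u\<bar>) ` ({0..1} \<times> {0..1})"
  then obtain u v where "u \<in> {0..1}" "v \<in> {0..1}" "x = \<bar>C u v - C v u\<bar>" by auto
  then show "x \<le> m" using assms(4)[of u v] assms(4)[of v u] by (simp add: abs_le_iff)
qed

lemma gini_gamma_range:
  assumes C: "copula C"
  shows "gini_gamma C \<in> {gamma_lower (asymmetry C)..gamma_upper (asymmetry C)}"
proof -
  let ?D = "\<lambda>u v. C v u" and ?m = "asymmetry C"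
  have D: "copula ?D" "gini_gamma ?D = gini_gamma C"
    by (simp_all only: copula_transpose[OF C] gini_gamma_eq[OF copula_transpose[OF C]]
        gini_gamma_eq[OF C] gini_integral_transpose[OF C])
  obtain u v where uv: "u \<in> {0..1}" "v \<in> {0..1}" "?m = \<bar>C u v - C v u\<bar>"
    using asymmetry_attained[OF C] by blast
  define a b where "a = min u v" and "b = max u v"
  have ab: "a \<in> {0..1}" "b \<in> {0..1}" "a \<le> b" using uv by (auto simp: a_def b_def)
  have "0 \<le> ?m" "C a b = C b a + ?m \<or> ?D a b = ?D b a + ?m"
    using uv(3) by (auto simp: a_def b_def min_def max_def abs_if)
  then show ?thesis
    using gini_gamma_bounds[OF C ab] gini_gamma_bounds[OF D(1) ab] D(2) by auto
qed

section \<open>Extremal copulas\<close>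

text \<open>Quantifying over the whole plane frees the closure rules from domain conditions;
  agreement on the unit square suffices to transfer the property to a copula.\<close>

definition two_increasing :: "(real \<Rightarrow> real \<Rightarrow> real) \<Rightarrow> bool" where
  "two_increasing F \<longleftrightarrow> (\<forall>u1 u2 v1 v2. u1 \<le> u2 \<longrightarrow> v1 \<le> v2 \<longrightarrow>
     F u2 v2 - F u2 v1 - F u1 v2 + F u1 v1 \<ge> 0)"

lemma two_increasing_add:
  assumes "two_increasing F" "two_increasing G"
  shows "two_increasing (\<lambda>u v. F u v + G u v)"
  unfolding two_increasing_def
proof (intro allI impI)
  fix u1 u2 v1 v2 :: real assume "u1 \<le> u2" "v1 \<le> v2"
  with assms have "F u2 v2 - F u2 v1 - F u1 v2 + F u1 v1 \<ge> 0" "G u2 v2 - G u2 v1 - G u1 v2 + G u1 v1 \<ge> 0"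
    by (auto simp: two_increasing_def)
  then show "F u2 v2 + G u2 v2 - (F u2 v1 + G u2 v1) - (F u1 v2 + G u1 v2) + (F u1 v1 + G u1 v1) \<ge> 0"
    by linarith
qed

text \<open>Such a function describes mass along the increasing curve
  \<open>p u = q v\<close>.\<close>

lemma two_increasing_min:
  assumes "mono p" "mono q"
  shows "two_increasing (\<lambda>u v. min (p u) (q v))"
  unfolding two_increasing_def
proof (intro allI impI)
  fix u1 u2 v1 v2 :: real assume "u1 \<le> u2" "v1 \<le> v2"
  with assms have "p u1 \<le> p u2" "q v1 \<le> q v2" by (auto simp: monoD)
  then show "min (p u2) (q v2) - min (p u2) (q v1) - min (p u1) (q v2) + min (p u1) (q v1) \<ge> 0"
    by (auto simp: min_def)
qed

text \<open>Since \<open>q\<close> is antitone, this describes mass along the decreasing curve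
  \<open>p u = q v\<close>.\<close>

lemma two_increasing_max_diff:
  assumes "mono p" "antimono q"
  shows "two_increasing (\<lambda>u v. max 0 (p u - q v))"
  unfolding two_increasing_def
proof (intro allI impI)
  fix u1 u2 v1 v2 :: real assume "u1 \<le> u2" "v1 \<le> v2"
  with assms have "p u1 \<le> p u2" "q v2 \<le> q v1" by (auto simp: monoD antimonoD)
  then show "max 0 (p u2 - q v2) - max 0 (p u2 - q v1) - max 0 (p u1 - q v2) + max 0 (p u1 - q v1) \<ge> 0"
    by (auto simp: max_def)
qed

lemma copulaI:
  assumes "two_increasing F" "\<And>u v. u \<in> {0..1} \<Longrightarrow> v \<in> {0..1} \<Longrightarrow> C u v = F u v"
    "\<And>u. u \<in> {0..1} \<Longrightarrow> C u 0 = 0 \<and> C 0 u = 0 \<and> C u 1 = u \<and> C 1 u = u"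
  shows "copula C"
  unfolding copula_def using assms by (simp add: two_increasing_def)

text \<open>Both extremal copulas are supported on the graph of a piecewise isometry of the unit interval.
  Each branch of the graph contributes one of the three summands below.\<close>

definition lower_copula :: "real \<Rightarrow> real \<Rightarrow> real \<Rightarrow> real" where
  "lower_copula m u v = max (max 0 (u + v - 1)) (m - ramp u m - ramp v (1 - m))"

text \<open>This is the one-sided Lipschitz bound from value 0 at (2m, m), capped by M. Dually,
  \<open>lower_copula\<close> descends from value m at (m, 1-m), with W as floor.\<close>

definition upper_copula :: "real \<Rightarrow> real \<Rightarrow> real \<Rightarrow> real" where
  "upper_copula m u v = min (min u v) (ramp (2 * m) u + ramp m v)"

text \<open>The branches are v = 1 - m - u on [0,m], v = 1 + m - u on [m,2m] and v = 1 - u on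
  [2m,1], all decreasing.\<close>

lemma lower_copula_decomposition:
  assumes "0 \<le> m" "m \<le> 1/3" "u \<in> {0..1}" "v \<in> {0..1}"
  shows "lower_copula m u v = max 0 (min u m - max 0 (1 - m - v)) +
    (max 0 (min u (2 * m) - max m (1 + m - v)) + max 0 (u - max (2 * m) (1 - v)))"
  using assms unfolding lower_copula_def atLeastAtMost_iff by (smt (verit))

text \<open>The branches are v = u + m on [0,2m], v = u - 2m on [2m,3m] and v = u on [3m,1], all
  increasing.\<close>

lemma upper_copula_decomposition:
  assumes "0 \<le> m" "m \<le> 1/3" "u \<in> {0..1}" "v \<in> {0..1}"
  shows "upper_copula m u v = min (min u (2 * m)) (max 0 (v - m)) +
    (min (max 0 (min u (3 * m) - 2 * m)) v + min (max 0 (u - 3 * m)) (max 0 (v - 3 * m)))"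
  using assms unfolding upper_copula_def atLeastAtMost_iff by (smt (verit))

lemma copula_lower_copula:
  assumes "0 \<le> m" "m \<le> 1/3"
  shows "copula (lower_copula m)"
proof (rule copulaI)
  show "two_increasing (\<lambda>u v. max 0 (min u m - max 0 (1 - m - v)) +
    (max 0 (min u (2 * m) - max m (1 + m - v)) + max 0 (u - max (2 * m) (1 - v))))"
    by (intro two_increasing_add two_increasing_max_diff) (auto simp: mono_def antimono_def)
  show "lower_copula m u 0 = 0 \<and> lower_copula m 0 u = 0 \<and> lower_copula m u 1 = u \<and> lower_copula m 1 u = u"
    if "u \<in> {0..1}" for u
    using assms that by (auto simp: lower_copula_def max_def)
qed (rule lower_copula_decomposition[OF assms])

lemma copula_upper_copula:
  assumes "0 \<le> m" "m \<le> 1/3"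
  shows "copula (upper_copula m)"
proof (rule copulaI)
  show "two_increasing (\<lambda>u v. min (min u (2 * m)) (max 0 (v - m)) +
    (min (max 0 (min u (3 * m) - 2 * m)) v + min (max 0 (u - 3 * m)) (max 0 (v - 3 * m))))"
    by (intro two_increasing_add two_increasing_min) (auto simp: mono_def)
  show "upper_copula m u 0 = 0 \<and> upper_copula m 0 u = 0 \<and> upper_copula m u 1 = u \<and> upper_copula m 1 u = u"
    if "u \<in> {0..1}" for u
    using assms that by (auto simp: upper_copula_def max_def min_def)
qed (rule upper_copula_decomposition[OF assms])

text \<open>The copula exceeds the symmetric W by at most m, so its oriented differences are at most
  m.\<close>

lemma asymmetry_lower_copula:
  assumes "0 \<le> m" "m \<le> 1/3"
  shows "asymmetry (lower_copula m) = m"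
proof (rule asymmetry_eqI[of m "1 - m"])
  show "\<bar>lower_copula m m (1 - m) - lower_copula m (1 - m) m\<bar> = m"
    using assms by (simp add: lower_copula_def)
  show "lower_copula m u v - lower_copula m v u \<le> m" for u v
    using assms unfolding lower_copula_def by (smt (verit))
qed (use assms in auto)

text \<open>The copula lies below the symmetric M by at most m, because
  \<open>ramp m v \<ge> v - m\<close>.\<close>

lemma asymmetry_upper_copula:
  assumes "0 \<le> m" "m \<le> 1/3"
  shows "asymmetry (upper_copula m) = m"
proof (rule asymmetry_eqI[of m "2 * m"])
  show "\<bar>upper_copula m m (2 * m) - upper_copula m (2 * m) m\<bar> = m"
    using assms by (simp add: upper_copula_def)
  show "upper_copula m u v - upper_copula m v u \<le> m" if "u \<in> {0..1}" "v \<in> {0..1}" for u v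
    using assms that unfolding upper_copula_def atLeastAtMost_iff by (smt (verit))
qed (use assms in auto)

lemma gini_gamma_lower_copula:
  assumes m: "0 \<le> m" "m \<le> 1/3"
  shows "gini_gamma (lower_copula m) = gamma_lower m"
proof -
  have "((\<lambda>t. lower_copula m t t) has_integral (gamma_lower m + 2) / 4 - m\<^sup>2) {0..1}"
    using diag_lower_has_integral[OF m]
  proof (rule has_integral_eq[rotated])
    show "max (max 0 (2 * t - 1)) (t - 1 + 2 * m) = lower_copula m t t" for t
      using m by (auto simp: lower_copula_def max_def)
  qed
  moreover have "((\<lambda>t. lower_copula m t (1 - t)) has_integral m\<^sup>2) {0..1}"
  proof (rule has_integral_eq)
    show "((\<lambda>t. max 0 (m - \<bar>t - m\<bar>)) has_integral m\<^sup>2) {0..1}"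
      using m by (intro tent_has_integral) auto
  qed (auto simp: lower_copula_def max_def abs_if)
  ultimately show ?thesis
    by (simp add: gini_gamma_eq[OF copula_lower_copula[OF m]] gini_integral_def integral_unique field_simps)
qed

lemma gini_gamma_upper_copula:
  assumes m: "0 \<le> m" "m \<le> 1/3"
  shows "gini_gamma (upper_copula m) = gamma_upper m"
proof -
  have "((\<lambda>t. upper_copula m t t) has_integral 1 / 2 - m * (2 * m - m) - m\<^sup>2) {0..1}"
  proof (rule has_integral_eq)
    show "((\<lambda>t. t - ramp (m - m) t + ramp m t + ramp (2 * m) t - ramp (2 * m + m) t) has_integral
        1 / 2 - m * (2 * m - m) - m\<^sup>2) {0..1}"
      using m by (intro diag_upper_has_integral) auto
  qed (use m in \<open>auto simp: upper_copula_def max_def min_def\<close>)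
  moreover have "((\<lambda>t. upper_copula m t (1 - t)) has_integral gamma_upper m / 4 + 2 * m\<^sup>2) {0..1}"
    using anti_upper_has_integral[OF m]
    by (rule has_integral_eq[rotated]) (auto simp: upper_copula_def algebra_simps)
  ultimately show ?thesis
    by (simp add: gini_gamma_eq[OF copula_upper_copula[OF m]] gini_integral_def integral_unique
        power2_eq_square field_simps)
qed

section \<open>Convex combinations and the symmetric case\<close>

lemma copula_convex_combination:
  assumes C: "copula C" and D: "copula D" and s: "0 \<le> s" "s \<le> 1"
  shows "copula (\<lambda>u v. (1 - s) * C u v + s * D u v)"
  unfolding copula_def
proof (intro conjI ballI impI)
  fix u1 u2 v1 v2 :: real
  assume "u1 \<in> {0..1}" "u2 \<in> {0..1}" "v1 \<in> {0..1}" "v2 \<in> {0..1}" "u1 \<le> u2" "v1 \<le> v2"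
  then have "0 \<le> (1 - s) * (C u2 v2 - C u2 v1 - C u1 v2 + C u1 v1)"
    "0 \<le> s * (D u2 v2 - D u2 v1 - D u1 v2 + D u1 v1)"
    using s copula_rectangle[OF C, of u1 u2 v1 v2] copula_rectangle[OF D, of u1 u2 v1 v2] by auto
  then show "0 \<le> (1 - s) * C u2 v2 + s * D u2 v2 - ((1 - s) * C u2 v1 + s * D u2 v1) -
      ((1 - s) * C u1 v2 + s * D u1 v2) + ((1 - s) * C u1 v1 + s * D u1 v1)"
    by (simp add: algebra_simps)
qed (use copula_zero[OF C] copula_zero[OF D] copula_one[OF C] copula_one[OF D] in
    \<open>auto simp: algebra_simps\<close>)

lemma gini_gamma_convex_combination:
  assumes C: "copula C" and D: "copula D" and s: "0 \<le> s" "s \<le> 1"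
  shows "gini_gamma (\<lambda>u v. (1 - s) * C u v + s * D u v) = (1 - s) * gini_gamma C + s * gini_gamma D"
proof -
  have "gini_integral (\<lambda>u v. (1 - s) * C u v + s * D u v) = (1 - s) * gini_integral C + s * gini_integral D"
    using copula_integrable[OF C] copula_integrable[OF D]
    by (simp add: gini_integral_def integral_add integrable_on_mult_right distrib_left)
  then show ?thesis
    unfolding gini_gamma_eq[OF copula_convex_combination[OF assms]] gini_gamma_eq[OF C] gini_gamma_eq[OF D]
    by (simp add: algebra_simps)
qed

text \<open>For m = 0 the extremal copulas are W and M on the unit square. Both are symmetric, and
  gamma is affine along the segment between them, running from -1 to 1.\<close>

lemma gini_gamma_symmetric_range:
  "{gini_gamma C |C. symmetric_copula C} = {-1..1}"
proof (intro equalityI subsetI)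
  fix x assume "x \<in> {gini_gamma C |C. symmetric_copula C}"
  then obtain C where C: "x = gini_gamma C" "copula C" "\<And>u v. u \<in> {0..1} \<Longrightarrow> v \<in> {0..1} \<Longrightarrow> C u v = C v u"
    unfolding symmetric_copula_def by blast
  have "asymmetry C = 0"
    by (rule asymmetry_eqI[of 0 0]) (use C(3) in auto)
  then show "x \<in> {-1..1}"
    using gini_gamma_range[OF C(2)] by (simp add: C(1) gamma_lower_def gamma_upper_def)
next
  fix x :: real assume x: "x \<in> {-1..1}"
  \<comment> \<open>The weight solves \<open>(1 - s) * (-1) + s * 1 = x\<close>.\<close>
  define s where "s = (x + 1) / 2"
  have s: "0 \<le> s" "s \<le> 1" using x by (auto simp: s_def)
  let ?C = "\<lambda>u v. (1 - s) * lower_copula 0 u v + s * upper_copula 0 u v"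
  have cop: "copula (lower_copula 0)" "copula (upper_copula 0)"
    by (simp_all add: copula_lower_copula copula_upper_copula)
  have "lower_copula 0 u v = lower_copula 0 v u" "upper_copula 0 u v = upper_copula 0 v u"
    if "u \<in> {0..1}" "v \<in> {0..1}" for u v
    using that by (auto simp: lower_copula_def upper_copula_def max_def min_def)
  then have "symmetric_copula ?C"
    using copula_convex_combination[OF cop s] by (auto simp: symmetric_copula_def)
  moreover have "gini_gamma ?C = x"
    unfolding gini_gamma_convex_combination[OF cop s]
    by (simp add: gini_gamma_lower_copula gini_gamma_upper_copula gamma_lower_def gamma_upper_def s_def field_simps)
  ultimately show "x \<in> {gini_gamma C |C. symmetric_copula C}" by blast
qed

theorem theorem18:
  shows "(\<forall>C m. copula C \<longrightarrow> asymmetry C = m \<longrightarrow> gini_gamma C \<in> {gamma_lower m .. gamma_upper m}) \<and>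
    (\<forall>m\<in>{0..1/3}.
       (\<exists>C. copula C \<and> asymmetry C = m \<and> gini_gamma C = gamma_lower m) \<and>
       (\<exists>C. copula C \<and> asymmetry C = m \<and> gini_gamma C = gamma_upper m)) \<and>
    {gini_gamma C |C. symmetric_copula C} = {-1..1} \<and>
    (\<forall>C. copula C \<longrightarrow> asymmetry C = 1/3 \<longrightarrow> gini_gamma C \<in> {-4/9 .. -1/3})"
proof (intro conjI allI impI ballI)
  fix C m assume "copula C" "asymmetry C = m"
  then show "gini_gamma C \<in> {gamma_lower m..gamma_upper m}" using gini_gamma_range by blast
next
  fix m :: real assume "m \<in> {0..1/3}"
  then have m: "0 \<le> m" "m \<le> 1/3" by auto
  show "\<exists>C. copula C \<and> asymmetry C = m \<and> gini_gamma C = gamma_lower m"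
    using copula_lower_copula[OF m] asymmetry_lower_copula[OF m] gini_gamma_lower_copula[OF m] by blast
  show "\<exists>C. copula C \<and> asymmetry C = m \<and> gini_gamma C = gamma_upper m"
    using copula_upper_copula[OF m] asymmetry_upper_copula[OF m] gini_gamma_upper_copula[OF m] by blast
next
  show "{gini_gamma C |C. symmetric_copula C} = {-1..1}" by (rule gini_gamma_symmetric_range)
next
  fix C assume "copula C" "asymmetry C = 1/3"
  then show "gini_gamma C \<in> {-4/9 .. -1/3}"
    using gini_gamma_range[of C] by (simp only: gamma_lower_def gamma_upper_def power2_eq_square) simp
qed

end
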